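(* Let $N\ge 1$, let $d\in\mathbb{R}$, let $P$ be a real $N\times N$ matrix, and let $V\in\mathbb{R}^N$. For $k\in\{1,\dots,N\}$ let $J_k$ be the $N\times N$ matrix whose only nonzero entry is $(J_k)_{kk}=1$, and let $I_d$ be the $N\times N$ identity matrix. Let $(i_n)_{n\ge 1}$ be any sequence with values in $\{1,\dots,N\}$. Define vectors $F_n,H_n\in\mathbb{R}^N$ by $$F_0=(1-d)V,\qquad F_n=(I_d-J_{i_n}+dPJ_{i_n})F_{n-1}\ (n\ge 1),$$ $$H_n=\sum_{k=1}^n J_{i_k}F_{k-1}\ (n\ge 0,\ \text{so } H_0=0).$$ Then for every $n\ge 0$, $$H_n+F_n=F_0+dPH_n.$$
   Context: In the paper's setting, $P$ is a nonnegative $N\times N$ matrix whose columns each sum to one, $V$ is a nonnegative vector with entries summing to one, and $d$ is a damping factor in $(0,1)$; the identity stated here is purely algebraic. $F_n$ is called the fluid vector and $H_n$ the history vector. *)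

theory Defs
  imports "HOL-Analysis.Analysis"
begin

definition J_mat :: "'n::finite \<Rightarrow> real ^ 'n ^ 'n" where
  "J_mat k = (\<chi> a b. if a = k \<and> b = k then 1 else 0)"

(* The index sequence starts at 1; the value i 0 is never used. *)
primrec fluid ::
  "real \<Rightarrow> real ^ 'n ^ 'n \<Rightarrow> real ^ 'n \<Rightarrow> (nat \<Rightarrow> 'n::finite) \<Rightarrow> nat \<Rightarrow> real ^ 'n" where
  "fluid d P V i 0 = (1 - d) *\<^sub>R V"
| "fluid d P V i (Suc n) =
     (mat 1 - J_mat (i (Suc n)) + d *\<^sub>R (P ** J_mat (i (Suc n)))) *v fluid d P V i n"

definition history ::
  "real \<Rightarrow> real ^ 'n ^ 'n \<Rightarrow> real ^ 'n \<Rightarrow> (nat \<Rightarrow> 'n::finite) \<Rightarrow> nat \<Rightarrow> real ^ 'n" where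
  "history d P V i n = (\<Sum>k = 1..n. J_mat (i k) *v fluid d P V i (k - 1))"

end

theory Submission
  imports Defs
begin

text \<open>Each step moves the fluid \<open>w\<close> at the chosen node into the history and
  returns \<open>d *\<^sub>R (P *v w)\<close> to the fluid. The sum of history and fluid thus grows
  by exactly the increment of the right-hand side, and induction applies.\<close>

lemma history_0 [simp]: "history d P V i 0 = 0"
  by (simp add: history_def)

lemma history_Suc:
  "history d P V i (Suc n) = history d P V i n + J_mat (i (Suc n)) *v fluid d P V i n"
  by (simp add: history_def)

text \<open>Distributing the step matrix exposes the same term that \<open>history_Suc\<close> adds,
  ready to cancel.\<close>

lemma fluid_Suc:
  "fluid d P V i (Suc n) = fluid d P V i n - J_mat (i (Suc n)) *v fluid d P V i n
     + d *\<^sub>R (P *v (J_mat (i (Suc n)) *v fluid d P V i n))"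
  by (simp add: matrix_vector_mult_add_rdistrib matrix_vector_mult_diff_rdistrib
      scaleR_matrix_vector_assoc matrix_vector_mul_assoc)

theorem theorem1:
  fixes d :: real and P :: "real ^ 'n ^ 'n" and V :: "real ^ 'n" and i :: "nat \<Rightarrow> 'n::finite"
  shows "\<forall>n. history d P V i n + fluid d P V i n
           = fluid d P V i 0 + d *\<^sub>R (P *v history d P V i n)"
proof
  fix n
  show "history d P V i n + fluid d P V i n
          = fluid d P V i 0 + d *\<^sub>R (P *v history d P V i n)"
  proof (induction n)
    case 0
    show ?case by simp
  next
    case (Suc n)
    define w where "w = J_mat (i (Suc n)) *v fluid d P V i n"
    have "history d P V i (Suc n) + fluid d P V i (Suc n)
        = (history d P V i n + fluid d P V i n) + d *\<^sub>R (P *v w)"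
      unfolding history_Suc fluid_Suc w_def by simp
    \<comment> \<open>After the induction hypothesis, linearity of \<open>P\<close> absorbs
      \<open>w\<close> into the history.\<close>
    also have "\<dots> = fluid d P V i 0 + d *\<^sub>R (P *v (history d P V i n + w))"
      unfolding Suc.IH by (simp add: matrix_vector_right_distrib scaleR_add_right)
    finally show ?case
      unfolding history_Suc w_def .
  qed
qed

end
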